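(* Define $\gamma_j:=c(0,j)/c(0,0)$. There exist scalars $\rho_j,\eta_j$, $j=1,2,\ldots$, such that all constants $\gamma_j$ can be recursively computed as a function of $\gamma_1$ by $$\gamma_j=\rho_j\gamma_1+\eta_j ,$$ where, under the assumption that $b_j^d>0$, the constants $\rho_j$ and $\eta_j$ are given by $$\rho_j=\frac{b_{j-1}^w\rho_{j-1}-b_{j-2}^u\rho_{j-2}}{b_j^d},\qquad \eta_j=\frac{b_{j-1}^w\eta_{j-1}-b_{j-2}^u\eta_{j-2}}{b_j^d}\qquad (j\ge3),$$ with initial values $\rho_1=1$, $\eta_1=0$, $\rho_2=b_1^w/b_2^d$, $\eta_2=-b_0^u/b_2^d$.
   Context: Indices run over $0,1,2,\ldots$. Let $b_i^d,b_i^u$ ($i\ge 0$) and $b_i^z$ ($i\ge1$) be non-negative real numbers and let $b_i^w=b_i^z+b_i^d+b_i^u>0$ for $i\ge1$. The infinite matrix $B=(B(i,j))_{i,j\ge0}$ is defined by: $B(0,0)=-b_0^d-b_0^u$, $B(0,1)=b_0^u$; $B(1,0)=b_1^d+b_1^z$, $B(1,1)=-b_1^w$, $B(1,2)=b_1^u$; and for $i\ge2$: $B(i,0)=b_i^z$, $B(i,i-1)=b_i^d$, $B(i,i)=-b_i^w$, $B(i,i+1)=b_i^u$; all other entries are $0$. It is assumed that $b_i^d>0$ and $b_i^u>0$ for all $i\ge0$. $C=(c(i,j))_{i,j\ge0}$ denotes the inverse of $B$, i.e. $C=B^{-1}$, so that $CB=BC=I$. Here $c(0,0)=-1/b_0^d\neq0$.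 *)

theory Defs
  imports Complex_Main
begin

definition total_rate ::
  "(nat \<Rightarrow> real) \<Rightarrow> (nat \<Rightarrow> real) \<Rightarrow> (nat \<Rightarrow> real) \<Rightarrow> nat \<Rightarrow> real"
where
  "total_rate bd bu bz i = bz i + bd i + bu i"

text \<open>The value \<open>bz 0\<close> is never used: the coefficients \<open>bz i\<close> are meaningful only for \<open>i \<ge> 1\<close>.\<close>

definition rate_matrix ::
  "(nat \<Rightarrow> real) \<Rightarrow> (nat \<Rightarrow> real) \<Rightarrow> (nat \<Rightarrow> real) \<Rightarrow> nat \<Rightarrow> nat \<Rightarrow> real"
where
  "rate_matrix bd bu bz i j =
    (if i = 0 then
       (if j = 0 then - bd 0 - bu 0
        else if j = 1 then bu 0
        else 0)
     else if i = 1 then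
       (if j = 0 then bd 1 + bz 1
        else if j = 1 then - total_rate bd bu bz 1
        else if j = 2 then bu 1
        else 0)
     else
       (if j = 0 then bz i
        else if j = i - 1 then bd i
        else if j = i then - total_rate bd bu bz i
        else if j = i + 1 then bu i
        else 0))"

text \<open>Products of infinite matrices are taken entrywise as convergent series, in the order of the
  index; absolute convergence is not required.\<close>

definition inf_mat_inverse :: "(nat \<Rightarrow> nat \<Rightarrow> real) \<Rightarrow> (nat \<Rightarrow> nat \<Rightarrow> real) \<Rightarrow> bool"
where
  "inf_mat_inverse B C \<longleftrightarrow>
     (\<forall>i j. (\<lambda>k. C i k * B k j) sums (if i = j then 1 else 0)) \<and>
     (\<forall>i j. (\<lambda>k. B i k * C k j) sums (if i = j then 1 else 0))"

definition gamma_ratio :: "(nat \<Rightarrow> nat \<Rightarrow> real) \<Rightarrow> nat \<Rightarrow> real" where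
  "gamma_ratio C j = C 0 j / C 0 0"

end

theory Submission
  imports Defs
begin

text \<open>
  Every column \<open>j \<ge> 1\<close> of the rate matrix vanishes outside the rows \<open>j - 1\<close>, \<open>j\<close> and \<open>j + 1\<close>,
  because the jumps with rate \<open>b\<^sup>z\<close> all lead to state \<open>0\<close> and so contribute only to column \<open>0\<close> and
  to the diagonal. Hence the entries \<open>(0, j)\<close> with \<open>j \<ge> 1\<close> of the identity \<open>CB = I\<close> are finite
  sums (\<open>left_inverse_row0_balance\<close>): they express the balance of flows at state \<open>j\<close>, for the
  first row of \<open>C\<close>. After division by \<open>c(0,0)\<close> and by the downward rate, \<open>\<gamma>\<close> satisfies a
  homogeneous linear recurrence of order two, starting from \<open>\<gamma>\<^sub>0 = 1\<close> and \<open>\<gamma>\<^sub>1\<close>.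

  The solutions of such a recurrence form a two-dimensional space, parametrised by the initial pair
  (\<open>balance_solution_unique\<close>). Hence \<open>\<gamma> = \<gamma>\<^sub>1 \<rho> + \<gamma>\<^sub>0 \<eta> = \<gamma>\<^sub>1 \<rho> + \<eta>\<close>, where \<open>\<rho>\<close> and \<open>\<eta>\<close>
  are the solutions with initial pairs \<open>(0, 1)\<close> and \<open>(1, 0)\<close>. Extending \<open>\<rho>\<close> and \<open>\<eta>\<close> to index \<open>0\<close>
  in this way makes the stated values at index \<open>2\<close> the first instance of the recurrence.
\<close>

fun balance_solution ::
  "(nat \<Rightarrow> real) \<Rightarrow> (nat \<Rightarrow> real) \<Rightarrow> (nat \<Rightarrow> real) \<Rightarrow> real \<Rightarrow> real \<Rightarrow> nat \<Rightarrow> real"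
where
  "balance_solution d u w x0 x1 0 = x0"
| "balance_solution d u w x0 x1 (Suc 0) = x1"
| "balance_solution d u w x0 x1 (Suc (Suc m)) =
     (w (Suc m) * balance_solution d u w x0 x1 (Suc m) - u m * balance_solution d u w x0 x1 m)
       / d (Suc (Suc m))"

lemma balance_solution_step:
  assumes "j \<ge> 2"
  shows "balance_solution d u w x0 x1 j =
    (w (j - 1) * balance_solution d u w x0 x1 (j - 1)
      - u (j - 2) * balance_solution d u w x0 x1 (j - 2)) / d j"
proof -
  have "j = Suc (Suc (j - 2))"
    using assms by simp
  then obtain m where "j = Suc (Suc m)" ..
  then show ?thesis by simp
qed

text \<open>The right-hand side solves the recurrence by linearity and has the same two initial values as \<open>f\<close>.\<close>

lemma balance_solution_unique:
  assumes "\<And>m. f (Suc (Suc m)) = (w (Suc m) * f (Suc m) - u m * f m) / d (Suc (Suc m))"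
  shows "f j = f 1 * balance_solution d u w 0 1 j + f 0 * balance_solution d u w 1 0 j"
proof (induction j rule: induct_nat_012)
  case (ge2 m)
  show ?case
    unfolding assms ge2 balance_solution.simps
    by (simp add: algebra_simps diff_divide_distrib add_divide_distrib)
qed simp_all

lemma rate_matrix_column:
  "rate_matrix bd bu bz k (Suc m) =
     (if k = m then bu m
      else if k = Suc m then - total_rate bd bu bz (Suc m)
      else if k = Suc (Suc m) then bd (Suc (Suc m))
      else 0)"
  by (auto simp: rate_matrix_def)

text \<open>The column of \<open>B\<close> has finite support, so the series defining \<open>(CB)(0, m + 1) = 0\<close> is a sum of
  three terms whatever the first row of \<open>C\<close> is.\<close>

lemma left_inverse_row0_balance:
  assumes "inf_mat_inverse (rate_matrix bd bu bz) C"
  shows "C 0 m * bu m - C 0 (Suc m) * total_rate bd bu bz (Suc m)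
    + C 0 (Suc (Suc m)) * bd (Suc (Suc m)) = 0"
proof -
  let ?t = "\<lambda>k. C 0 k * rate_matrix bd bu bz k (Suc m)"
  have "?t sums (\<Sum>k\<in>{m, Suc m, Suc (Suc m)}. ?t k)"
    by (rule sums_finite) (auto simp: rate_matrix_column)
  moreover have "?t sums 0"
    using assms[unfolded inf_mat_inverse_def, THEN conjunct1, rule_format, of 0 "Suc m"] by simp
  ultimately have "(\<Sum>k\<in>{m, Suc m, Suc (Suc m)}. ?t k) = 0"
    by (rule sums_unique2)
  then show ?thesis
    by (simp add: rate_matrix_column)
qed

lemma gamma_ratio_recurrence:
  assumes "inf_mat_inverse (rate_matrix bd bu bz) C"
    and "bd (Suc (Suc m)) \<noteq> 0"
  shows "gamma_ratio C (Suc (Suc m)) =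
    (total_rate bd bu bz (Suc m) * gamma_ratio C (Suc m) - bu m * gamma_ratio C m)
      / bd (Suc (Suc m))"
proof -
  have "C 0 (Suc (Suc m)) =
      (total_rate bd bu bz (Suc m) * C 0 (Suc m) - bu m * C 0 m) / bd (Suc (Suc m))"
    using left_inverse_row0_balance[OF assms(1), of m] assms(2) by (simp add: field_simps)
  then show ?thesis
    by (simp add: gamma_ratio_def diff_divide_distrib mult.commute)
qed

theorem proposition2:
  fixes bd bu bz bw :: "nat \<Rightarrow> real"
    and B C :: "nat \<Rightarrow> nat \<Rightarrow> real"
    and \<gamma> :: "nat \<Rightarrow> real"
  defines "bw \<equiv> total_rate bd bu bz"
    and "B \<equiv> rate_matrix bd bu bz"
    and "\<gamma> \<equiv> gamma_ratio C"
  assumes bd_pos: "\<And>i. bd i > 0"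
    and bu_pos: "\<And>i. bu i > 0"
    and bz_nonneg: "\<And>i. i \<ge> 1 \<Longrightarrow> bz i \<ge> 0"
    and bw_pos: "\<And>i. i \<ge> 1 \<Longrightarrow> bw i > 0"
    and inverse: "inf_mat_inverse B C"
    and c00: "C 0 0 = - 1 / bd 0"
  shows "\<exists>\<rho> \<eta> :: nat \<Rightarrow> real.
     \<rho> 1 = 1 \<and> \<eta> 1 = 0 \<and>
     \<rho> 2 = bw 1 / bd 2 \<and> \<eta> 2 = - bu 0 / bd 2 \<and>
     (\<forall>j\<ge>3. \<rho> j = (bw (j - 1) * \<rho> (j - 1) - bu (j - 2) * \<rho> (j - 2)) / bd j) \<and>
     (\<forall>j\<ge>3. \<eta> j = (bw (j - 1) * \<eta> (j - 1) - bu (j - 2) * \<eta> (j - 2)) / bd j) \<and>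
     (\<forall>j\<ge>1. \<gamma> j = \<rho> j * \<gamma> 1 + \<eta> j)"
proof -
  let ?\<rho> = "balance_solution bd bu bw 0 1" and ?\<eta> = "balance_solution bd bu bw 1 0"
  have rec: "\<gamma> (Suc (Suc m)) = (bw (Suc m) * \<gamma> (Suc m) - bu m * \<gamma> m) / bd (Suc (Suc m))" for m
    unfolding \<gamma>_def bw_def
    by (rule gamma_ratio_recurrence[OF inverse[unfolded B_def]])
       (use bd_pos[of "Suc (Suc m)"] in simp)
  have "\<gamma> 0 = 1"
    using c00 bd_pos[of 0] by (simp add: \<gamma>_def gamma_ratio_def)
  then have affine: "\<gamma> j = ?\<rho> j * \<gamma> 1 + ?\<eta> j" for j
    using balance_solution_unique[of \<gamma> bw bu bd j, OF rec] by (simp add: mult.commute)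
  have "?\<rho> 2 = bw 1 / bd 2" and "?\<eta> 2 = - bu 0 / bd 2"
    by (simp_all add: numeral_2_eq_2)
  then show ?thesis
    by (intro exI[of _ ?\<rho>] exI[of _ ?\<eta>] conjI allI impI balance_solution_step affine) simp_all
qed

end
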